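(* Let $\mathcal{P}_1,\ldots,\mathcal{P}_m \subset \mathbb{R}^N$ be lattice polytopes. Then: (1) The Cayley sum $\mathcal{P}_1*\cdots*\mathcal{P}_m$ has the integer decomposition property if and only if each $\mathcal{P}_i$ has the integer decomposition property and, for all nonnegative integers $a_1,\ldots,a_m$, the tuple $(a_1\mathcal{P}_1,\ldots,a_m\mathcal{P}_m)$ is IDP. In this case, for all nonnegative integers $a_1,\ldots,a_m$, the Minkowski sum $\sum_{i=1}^m a_i\mathcal{P}_i$ has the integer decomposition property. (2) If $\mathcal{P}_1*\cdots*\mathcal{P}_m$ is level of index $m$, then $\mathcal{P}_1+\cdots+\mathcal{P}_m$ is level of index $1$.
   Context: A lattice polytope is a convex polytope all of whose vertices lie in $\mathbb{Z}^N$. For $n\ge 0$, $n\mathcal{P}=\{n\mathbf{x}:\mathbf{x}\in\mathcal{P}\}$. A lattice polytope $\mathcal{P}\subset\mathbb{R}^N$ has the integer decomposition property (is IDP) if for every integer $n\ge1$, $n\mathcal{P}\cap\mathbb{Z}^N=((n-1)\mathcal{P}\cap\mathbb{Z}^N)+(\mathcal{P}\cap\mathbb{Z}^N)$. The Minkowski sum is $\mathcal{P}_1+\cdots+\mathcal{P}_m=\{\mathbf{a}_1+\cdots+\mathbf{a}_m:\mathbf{a}_i\in\mathcal{P}_i\}$. The Cayley sum is $\mathcal{P}_1*\cdots*\mathcal{P}_m=\mathrm{conv}(\{\mathbf{e}_1\}\times\mathcal{P}_1\cup\cdots\cup\{\mathbf{e}_m\}\times\mathcal{P}_m)\subset\mathbb{R}^m\times\mathbb{R}^N$,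 where $\mathbf{e}_1,\ldots,\mathbf{e}_m$ are the standard unit vectors of $\mathbb{R}^m$. A tuple $(\mathcal{Q}_1,\ldots,\mathcal{Q}_m)$ of lattice polytopes in $\mathbb{R}^N$ is IDP if for every nonempty $I\subset\{1,\ldots,m\}$, $(\sum_{i\in I}\mathcal{Q}_i)\cap\mathbb{Z}^N=\sum_{i\in I}(\mathcal{Q}_i\cap\mathbb{Z}^N)$. For $A\subset\mathbb{R}^N$, $\mathrm{int}(A)$ denotes the relative interior of $A$ in its affine span. A lattice polytope $\mathcal{P}\subset\mathbb{R}^N$ is level of index $r$ if $r=\min\{t\in\mathbb{Z}_{>0}:\mathrm{int}(t\mathcal{P})\cap\mathbb{Z}^N\neq\emptyset\}$ and for every integer $n\ge r$, $\mathrm{int}(n\mathcal{P})\cap\mathbb{Z}^N=(\mathrm{int}(r\mathcal{P})\cap\mathbb{Z}^N)+((n-r)\mathcal{P}\cap\mathbb{Z}^N)$. *)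

theory Defs
  imports "HOL-Analysis.Analysis" "HOL-Library.Set_Algebras"
begin

text \<open>
  Minkowski sums are the pointwise \<open>+\<close> and \<open>\<Sum>\<close> on sets from \<^theory>\<open>HOL-Library.Set_Algebras\<close>.
\<close>

text \<open>
  The standard lattice. Stating it through \<^const>\<open>Basis\<close> covers both
  \<open>\<int>\<^sup>N\<close> in \<open>real^'n\<close> and \<open>\<int>\<^sup>m \<times> \<int>\<^sup>N\<close> in \<open>(real^'m) \<times> (real^'n)\<close>; see the two lemmas below.
\<close>

definition int_points :: "'a::euclidean_space set" where
  "int_points = {x. \<forall>b\<in>Basis. x \<bullet> b \<in> \<int>}"

lemma int_points_vec: "(int_points :: (real^'n) set) = {x. \<forall>i. x $ i \<in> \<int>}"
  by (auto simp: int_points_def Basis_vec_def inner_axis)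

lemma int_points_prod:
  "(int_points :: ('a::euclidean_space \<times> 'b::euclidean_space) set) = int_points \<times> int_points"
  by (auto simp: int_points_def Basis_prod_def ball_Un)

text \<open>
  Polytopes are nonempty by convention, whereas \<^const>\<open>polytope\<close> admits the empty set.
\<close>

definition lattice_polytope :: "'a::euclidean_space set \<Rightarrow> bool" where
  "lattice_polytope P \<longleftrightarrow>
     polytope P \<and> P \<noteq> {} \<and> (\<forall>v. v extreme_point_of P \<longrightarrow> v \<in> int_points)"

definition dilate :: "nat \<Rightarrow> 'a::real_vector set \<Rightarrow> 'a set" where
  "dilate n P = (\<lambda>x. real n *\<^sub>R x) ` P"

definition idp :: "'a::euclidean_space set \<Rightarrow> bool" where
  "idp P \<longleftrightarrow> lattice_polytope P \<and>
     (\<forall>n\<ge>1. dilate n P \<inter> int_points =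
              (dilate (n - 1) P \<inter> int_points) + (P \<inter> int_points))"

definition idp_tuple :: "('m::finite \<Rightarrow> 'a::euclidean_space set) \<Rightarrow> bool" where
  "idp_tuple Q \<longleftrightarrow> (\<forall>i. lattice_polytope (Q i)) \<and>
     (\<forall>I. I \<noteq> {} \<longrightarrow> (\<Sum>i\<in>I. Q i) \<inter> int_points = (\<Sum>i\<in>I. Q i \<inter> int_points))"

definition cayley_sum :: "('m::finite \<Rightarrow> (real^'n) set) \<Rightarrow> ((real^'m) \<times> (real^'n)) set" where
  "cayley_sum P = convex hull (\<Union>i. {axis i 1} \<times> P i)"

definition level_of_index :: "'a::euclidean_space set \<Rightarrow> nat \<Rightarrow> bool" where
  "level_of_index P r \<longleftrightarrow> lattice_polytope P \<and>
     r > 0 \<and> rel_interior (dilate r P) \<inter> int_points \<noteq> {} \<and>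
     (\<forall>t>0. rel_interior (dilate t P) \<inter> int_points \<noteq> {} \<longrightarrow> r \<le> t) \<and>
     (\<forall>n\<ge>r. rel_interior (dilate n P) \<inter> int_points =
              (rel_interior (dilate r P) \<inter> int_points) + (dilate (n - r) P \<inter> int_points))"

end

theory Submission imports Defs begin

text \<open>
  A lattice point of the \<open>n\<close>-th dilate of the Cayley sum is a pair \<open>(a, x)\<close> of a vector \<open>a\<close> of natural
  numbers with coordinate sum \<open>n\<close> and a lattice point \<open>x\<close> of \<open>\<Sum>i. a i P i\<close>. Removing one lattice
  point of the Cayley sum lowers one coordinate of \<open>a\<close> by one. Hence the Cayley sum is IDP iff, for
  every \<open>a\<close>, each lattice point of \<open>\<Sum>i. a i P i\<close> is a sum of \<open>a i\<close> lattice points from every \<open>P i\<close>,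
  and the other IDP conditions follow by specialising \<open>a\<close>.

  The relative interior of the dilate lies over the strictly positive \<open>a\<close>, with fibre the relative
  interior of \<open>\<Sum>i. a i P i\<close>. For \<open>n\<close> the number \<open>m\<close> of polytopes this forces \<open>a = (1, \<dots>, 1)\<close>, so
  applying levelness of the Cayley sum over \<open>(n, \<dots>, n)\<close> gives levelness of the Minkowski sum.
\<close>

text \<open>Keeps \<open>0\<close> as the neutral element, so that the monoid simp rules apply to sums of sets.\<close>
declare set_zero [simp del]

section \<open>Lattice polytopes as hulls of finite sets of lattice points\<close>

text \<open>By Krein-Milman a polytope is the hull of its extreme points, and conversely every
  extreme point of a hull lies in the generating set. This form lets closure properties be proved by
  exhibiting generators, without computing extreme points.\<close>

lemma lattice_polytope_iff:
  "lattice_polytope S \<longleftrightarrow>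
     (\<exists>V. finite V \<and> V \<noteq> {} \<and> V \<subseteq> int_points \<and> S = convex hull V)"
proof
  assume S: "lattice_polytope S"
  let ?V = "{x. x extreme_point_of S}"
  obtain W where W: "finite W" "S = convex hull W"
    using S by (auto simp: lattice_polytope_def polytope_def)
  have "?V \<subseteq> W" using W extreme_points_of_convex_hull by auto
  then have "finite ?V" using W finite_subset by blast
  moreover have "S = convex hull ?V"
    using W Krein_Milman_polytope by simp
  moreover have "?V \<noteq> {}"
    using S calculation(2) by (metis convex_hull_eq_empty lattice_polytope_def)
  ultimately show "\<exists>V. finite V \<and> V \<noteq> {} \<and> V \<subseteq> int_points \<and> S = convex hull V"
    using S by (intro exI[of _ ?V]) (auto simp: lattice_polytope_def)
next
  assume "\<exists>V. finite V \<and> V \<noteq> {} \<and> V \<subseteq> int_points \<and> S = convex hull V"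
  then show "lattice_polytope S"
    by (auto simp: lattice_polytope_def polytope_convex_hull dest!: extreme_point_of_convex_hull)
qed

lemma lattice_polytope_convex: "lattice_polytope S \<Longrightarrow> convex S"
  by (simp add: lattice_polytope_def polytope_imp_convex)

lemma lattice_polytope_nonempty: "lattice_polytope S \<Longrightarrow> S \<noteq> {}"
  by (simp add: lattice_polytope_def)

lemma int_points_0 [simp]: "0 \<in> int_points"
  by (simp add: int_points_def)

lemma zero_Int_int_points [simp]: "0 \<inter> int_points = 0"
  by (auto simp: set_zero)

lemma int_points_add: "x \<in> int_points \<Longrightarrow> y \<in> int_points \<Longrightarrow> x + y \<in> int_points"
  by (simp add: int_points_def inner_add_left)

lemma int_points_scale: "x \<in> int_points \<Longrightarrow> real n *\<^sub>R x \<in> int_points"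
  by (simp add: int_points_def)

lemma lattice_polytope_zero: "lattice_polytope (0 :: 'a::euclidean_space set)"
  unfolding lattice_polytope_iff by (intro exI[of _ "{0}"]) (simp add: set_zero)

lemma lattice_polytope_plus:
  assumes "lattice_polytope S" "lattice_polytope T"
  shows "lattice_polytope (S + T)"
proof -
  obtain V W where V: "finite V" "V \<noteq> {}" "V \<subseteq> int_points" "S = convex hull V"
    and W: "finite W" "W \<noteq> {}" "W \<subseteq> int_points" "T = convex hull W"
    using assms unfolding lattice_polytope_iff by blast
  show ?thesis
    unfolding lattice_polytope_iff
  proof (intro exI[of _ "V + W"] conjI)
    show "V + W \<noteq> {}" using V(2) W(2) by (auto simp: set_plus_def)
    show "V + W \<subseteq> int_points" using V W by (auto simp: set_plus_def intro: int_points_add)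
  qed (use V W in \<open>auto simp: finite_set_plus convex_hull_set_plus\<close>)
qed

lemma lattice_polytope_sum:
  "(\<And>i. i \<in> I \<Longrightarrow> lattice_polytope (S i)) \<Longrightarrow> lattice_polytope (\<Sum>i\<in>I. S i)"
  by (induction I rule: infinite_finite_induct)
     (auto simp: lattice_polytope_zero intro: lattice_polytope_plus)

lemma lattice_polytope_dilate:
  assumes "lattice_polytope S"
  shows "lattice_polytope (dilate n S)"
proof -
  obtain V where V: "finite V" "V \<noteq> {}" "V \<subseteq> int_points" "S = convex hull V"
    using assms unfolding lattice_polytope_iff by blast
  then show ?thesis
    unfolding lattice_polytope_iff dilate_def
    by (intro exI[of _ "(\<lambda>x. real n *\<^sub>R x) ` V"])
       (auto simp: convex_hull_scaling intro: int_points_scale)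
qed

text \<open>The hull of a union of hulls is the hull of the union of the generating sets, so lifting
  the generators of each \<open>P i\<close> to height \<open>axis i 1\<close> gives finitely many
  lattice generators.\<close>

lemma lattice_polytope_cayley_sum:
  fixes P :: "'m::finite \<Rightarrow> (real^'n) set"
  assumes "\<And>i. lattice_polytope (P i)"
  shows "lattice_polytope (cayley_sum P)"
proof -
  have "\<forall>i. \<exists>V. finite V \<and> V \<noteq> {} \<and> V \<subseteq> int_points \<and> P i = convex hull V"
    using assms unfolding lattice_polytope_iff by blast
  then obtain V where V: "\<And>i. finite (V i)" "\<And>i. V i \<noteq> {}"
    "\<And>i. V i \<subseteq> int_points" "\<And>i. P i = convex hull V i"
    by metis
  let ?W = "\<Union>i. {axis i 1} \<times> V i"
  have "cayley_sum P = convex hull ?W"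
    unfolding cayley_sum_def
  proof (rule subset_antisym)
    have "{axis i 1} \<times> P i \<subseteq> convex hull ?W" for i
    proof -
      have "{axis i 1} \<times> P i = convex hull ({axis i 1} \<times> V i)"
        by (simp add: V convex_hull_Times)
      also have "\<dots> \<subseteq> convex hull ?W"
        by (rule hull_mono) auto
      finally show ?thesis .
    qed
    then show "convex hull (\<Union>i. {axis i 1} \<times> P i) \<subseteq> convex hull ?W"
      by (intro hull_minimal) auto
    show "convex hull ?W \<subseteq> convex hull (\<Union>i. {axis i 1} \<times> P i)"
      using V by (intro hull_mono) (auto intro: hull_inc)
  qed
  moreover have "(axis i 1 :: real^'m) \<in> int_points" for i
    by (auto simp: int_points_vec axis_def)
  ultimately show ?thesis
    unfolding lattice_polytope_iff
    using V(1,2) V(3)[THEN subsetD] by (intro exI[of _ ?W]) (auto simp: int_points_prod)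
qed

lemma convex_cayley_sum: "convex (cayley_sum P)"
  by (simp add: cayley_sum_def)

section \<open>Dilates of convex sets\<close>

lemma dilate_0 [simp]: "S \<noteq> {} \<Longrightarrow> dilate 0 S = 0"
  by (auto simp: dilate_def set_zero)

lemma dilate_1 [simp]: "dilate (Suc 0) S = S"
  by (simp add: dilate_def)

lemma dilate_dilate: "dilate m (dilate n S) = dilate (m * n) S"
  by (simp add: dilate_def image_image)

lemma dilate_plus: "dilate n (S + T) = dilate n S + dilate n T"
  unfolding dilate_def set_plus_image image_image
  by (force simp: scaleR_add_right image_iff)

lemma dilate_sum: "dilate n (\<Sum>i\<in>I. S i) = (\<Sum>i\<in>I. dilate n (S i))"
  by (induction I rule: infinite_finite_induct) (simp_all add: dilate_plus, auto simp: dilate_def set_zero)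

lemma convex_dilate: "convex S \<Longrightarrow> convex (dilate n S)"
  unfolding dilate_def by (rule convex_scaling)

lemma rel_interior_dilate:
  fixes S :: "'a::euclidean_space set"
  shows "convex S \<Longrightarrow> rel_interior (dilate n S) = dilate n (rel_interior S)"
  unfolding dilate_def by (simp add: rel_interior_convex_scaleR)

text \<open>Convexity gives the inclusion from right to left: \<open>m x + n y\<close> is
  \<open>m + n\<close> times the weighted mean of \<open>x\<close> and \<open>y\<close>. The weights
  divide by \<open>m + n\<close>, hence the separate case of zero.\<close>

lemma dilate_add:
  assumes "convex S"
  shows "dilate (m + n) S = dilate m S + dilate n S"
proof (cases "m + n = 0")
  case True
  then show ?thesis by (cases "S = {}") (auto simp: dilate_def set_plus_def)
next
  case False
  show ?thesis
  proof
    show "dilate (m + n) S \<subseteq> dilate m S + dilate n S"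
      by (force simp: dilate_def scaleR_add_left set_plus_def)
    show "dilate m S + dilate n S \<subseteq> dilate (m + n) S"
    proof
      fix z assume "z \<in> dilate m S + dilate n S"
      then obtain x y where xy: "x \<in> S" "y \<in> S" "z = real m *\<^sub>R x + real n *\<^sub>R y"
        by (auto simp: dilate_def set_plus_def)
      let ?w = "(m / (m + n)) *\<^sub>R x + (n / (m + n)) *\<^sub>R y"
      have "?w \<in> S"
        using False by (intro convexD assms xy) (auto simp flip: add_divide_distrib)
      moreover have "z = real (m + n) *\<^sub>R ?w"
        using False by (simp add: xy scaleR_add_right del: of_nat_add)
      ultimately show "z \<in> dilate (m + n) S"
        unfolding dilate_def by blast
    qed
  qed
qed

text \<open>The point \<open>y + n z\<close> is \<open>n + 1\<close> times a point of the segment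
  from \<open>z\<close> to \<open>y\<close> other than \<open>z\<close>. As \<open>y\<close> is
  relatively interior, so is every such point.\<close>

lemma rel_interior_plus_dilate_subset:
  fixes S :: "'a::euclidean_space set"
  assumes "convex S"
  shows "rel_interior S + dilate n S \<subseteq> rel_interior (dilate (Suc n) S)"
proof
  fix x assume "x \<in> rel_interior S + dilate n S"
  then obtain y z where yz: "y \<in> rel_interior S" "z \<in> S" "x = y + real n *\<^sub>R z"
    by (auto simp: set_plus_def dilate_def)
  let ?w = "z - (1 / real (Suc n)) *\<^sub>R (z - y)"
  have "?w \<in> rel_interior S"
    using assms yz by (intro rel_interior_convex_shrink) auto
  moreover have "x = real (Suc n) *\<^sub>R ?w"
    by (simp add: yz scaleR_diff_right scaleR_left_distrib del: of_nat_Suc) (simp add: scaleR_left_distrib)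
  ultimately show "x \<in> rel_interior (dilate (Suc n) S)"
    unfolding rel_interior_dilate[OF assms] unfolding dilate_def by blast
qed

section \<open>Iterated Minkowski sums and the integer decomposition property\<close>

text \<open>Written as a sum over a constant family, so that exchanging the order of summation
  applies to sums of \<open>multisum\<close> terms.\<close>

definition multisum :: "nat \<Rightarrow> 'a::comm_monoid_add set \<Rightarrow> 'a set" where
  "multisum n A = (\<Sum>_<n. A)"

lemma multisum_0 [simp]: "multisum 0 A = 0"
  by (simp add: multisum_def)

lemma multisum_Suc: "multisum (Suc n) A = multisum n A + A"
  by (simp add: multisum_def add.commute)

lemma multisum_1 [simp]: "multisum (Suc 0) A = A"
  by (simp add: multisum_def)

lemma multisum_add: "multisum (m + n) A = multisum m A + multisum n A"
  by (induction n) (simp_all add: multisum_def add.assoc)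

lemma multisum_diff_1: "n \<ge> 1 \<Longrightarrow> multisum n A = multisum (n - 1) A + A"
  using multisum_add[of "n - 1" 1 A] by simp

lemma int_points_Int_plus_subset:
  "(S \<inter> int_points) + (T \<inter> int_points) \<subseteq> (S + T) \<inter> int_points"
  by (auto simp: set_plus_def intro: int_points_add)

lemma int_points_Int_sum_subset:
  "(\<Sum>i\<in>I. S i \<inter> int_points) \<subseteq> (\<Sum>i\<in>I. S i) \<inter> int_points"
proof (induction I rule: infinite_finite_induct)
  case (insert i I)
  have "(S i \<inter> int_points) + (\<Sum>i\<in>I. S i \<inter> int_points)
      \<subseteq> (S i \<inter> int_points) + ((\<Sum>i\<in>I. S i) \<inter> int_points)"
    using insert.IH by (rule set_plus_mono2[OF order_refl])
  also have "\<dots> \<subseteq> (S i + (\<Sum>i\<in>I. S i)) \<inter> int_points"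
    by (rule int_points_Int_plus_subset)
  finally show ?case using insert by simp
qed auto

lemma set_sum_mono:
  fixes A B :: "'b \<Rightarrow> 'a::comm_monoid_add set"
  assumes "\<And>i. i \<in> I \<Longrightarrow> A i \<subseteq> B i"
  shows "(\<Sum>i\<in>I. A i) \<subseteq> (\<Sum>i\<in>I. B i)"
  using assms by (induction I rule: infinite_finite_induct) (simp_all add: set_plus_mono2)

lemma multisum_subset_dilate:
  assumes "convex S" "S \<noteq> {}"
  shows "multisum n (S \<inter> int_points) \<subseteq> dilate n S \<inter> int_points"
proof (induction n)
  case 0
  then show ?case using assms by (simp add: set_zero)
next
  case (Suc n)
  have "multisum n (S \<inter> int_points) + (S \<inter> int_points) \<subseteq> (dilate n S \<inter> int_points) + (S \<inter> int_points)"
    using Suc by (rule set_plus_mono2) simp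
  also have "\<dots> \<subseteq> (dilate n S + S) \<inter> int_points"
    by (rule int_points_Int_plus_subset)
  finally show ?case
    using dilate_add[of S n 1] assms by (simp add: multisum_Suc)
qed

text \<open>Unrolling the one-step recursion of \<open>idp\<close> down to \<open>n = 0\<close>,
  where both sides are \<open>{0}\<close> because \<open>S\<close> is nonempty, gives a closed form
  that can be compared across several polytopes.\<close>

lemma idp_iff:
  assumes "lattice_polytope S"
  shows "idp S \<longleftrightarrow> (\<forall>n. dilate n S \<inter> int_points = multisum n (S \<inter> int_points))"
proof
  assume S: "idp S"
  have "dilate n S \<inter> int_points = multisum n (S \<inter> int_points)" for n
  proof (induction n)
    case 0
    then show ?case by (simp add: assms lattice_polytope_nonempty)
  next
    case (Suc n)
    have "dilate (Suc n) S \<inter> int_points = (dilate n S \<inter> int_points) + (S \<inter> int_points)"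
      using S unfolding idp_def by (metis One_nat_def diff_Suc_1 le_add1 plus_1_eq_Suc)
    then show ?case by (simp add: Suc multisum_Suc)
  qed
  then show "\<forall>n. dilate n S \<inter> int_points = multisum n (S \<inter> int_points)" by simp
next
  assume "\<forall>n. dilate n S \<inter> int_points = multisum n (S \<inter> int_points)"
  then show "idp S"
    using assms multisum_diff_1[where A="S \<inter> int_points"] by (simp add: idp_def)
qed

section \<open>Lattice points of dilates of the Cayley sum\<close>

text \<open>Pulling the factor \<open>a i\<close> out of each summand gives the same shape as the
  second component of a mixture with coefficient vector \<open>a\<close>, so the fibres of the
  Cayley sum can be matched with Minkowski sums.\<close>

lemma mem_set_sum_dilate:
  fixes A :: "'m::finite \<Rightarrow> 'a::real_vector set"
  shows "x \<in> (\<Sum>i\<in>UNIV. dilate (a i) (A i)) \<longleftrightarrow>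
    (\<exists>p. (\<forall>i. p i \<in> A i) \<and> x = (\<Sum>i\<in>UNIV. real (a i) *\<^sub>R p i))"
proof -
  have "x \<in> (\<Sum>i\<in>UNIV. dilate (a i) (A i)) \<longleftrightarrow>
    (\<exists>s. (\<forall>i. s i \<in> dilate (a i) (A i)) \<and> x = (\<Sum>i\<in>UNIV. s i))"
    by (auto simp: set_sum_alt)
  also have "\<dots> \<longleftrightarrow> (\<exists>p. (\<forall>i. p i \<in> A i) \<and> x = (\<Sum>i\<in>UNIV. real (a i) *\<^sub>R p i))"
  proof
    assume "\<exists>s. (\<forall>i. s i \<in> dilate (a i) (A i)) \<and> x = (\<Sum>i\<in>UNIV. s i)"
    then obtain s where s: "\<And>i. s i \<in> dilate (a i) (A i)" "x = (\<Sum>i\<in>UNIV. s i)" by blast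
    then have "\<forall>i. \<exists>p. p \<in> A i \<and> s i = real (a i) *\<^sub>R p"
      by (fastforce simp: dilate_def)
    then obtain p where "\<And>i. p i \<in> A i \<and> s i = real (a i) *\<^sub>R p i" by metis
    then show "\<exists>p. (\<forall>i. p i \<in> A i) \<and> x = (\<Sum>i\<in>UNIV. real (a i) *\<^sub>R p i)"
      using s by auto
  qed (force simp: dilate_def)
  finally show ?thesis .
qed

text \<open>Taking \<open>Q\<close> to be \<open>(\<le>) 0\<close> describes dilates of the Cayley sum, and \<open>(<) 0\<close> their relative interiors.\<close>

lemma mem_dilate_mixtures:
  fixes A :: "'m::finite \<Rightarrow> (real^'n) set" and Q :: "real \<Rightarrow> bool"
  assumes n: "n > 0" and Q: "\<And>k c. k > 0 \<Longrightarrow> Q (k * c) \<longleftrightarrow> Q c"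
  shows "(l, x) \<in> dilate n {\<Sum>i\<in>UNIV. c i *\<^sub>R s i | c s.
       (\<forall>i. Q (c i)) \<and> sum c UNIV = 1 \<and> (\<forall>i. s i \<in> {axis i 1} \<times> A i)} \<longleftrightarrow>
     (\<forall>i. Q (l $ i)) \<and> (\<Sum>i\<in>UNIV. l $ i) = real n \<and>
     (\<exists>p. (\<forall>i. p i \<in> A i) \<and> x = (\<Sum>i\<in>UNIV. l $ i *\<^sub>R p i))"
    (is "_ \<in> dilate n ?M \<longleftrightarrow> ?R")
proof -
  \<comment> \<open>The vectors \<open>axis i 1\<close> are the standard basis, so the first
    component of a mixture is its coefficient vector.\<close>
  have mix: "(\<Sum>i\<in>UNIV. c i *\<^sub>R (axis i 1, p i)) = ((\<chi> i. c i), (\<Sum>i\<in>UNIV. c i *\<^sub>R p i))"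
    for c and p :: "'m \<Rightarrow> real^'n"
    by (simp add: sum_prod vec_eq_iff axis_def if_distrib cong: if_cong)
  have M: "?M = {((\<chi> i. c i), (\<Sum>i\<in>UNIV. c i *\<^sub>R p i)) | c p.
       (\<forall>i. Q (c i)) \<and> sum c UNIV = 1 \<and> (\<forall>i. p i \<in> A i)}" (is "_ = ?M'")
  proof
    show "?M \<subseteq> ?M'"
    proof
      fix z assume "z \<in> ?M"
      then obtain c s where cs: "z = (\<Sum>i\<in>UNIV. c i *\<^sub>R s i)" "\<forall>i. Q (c i)" "sum c UNIV = 1"
        "\<forall>i. s i \<in> {axis i 1} \<times> A i" by blast
      define p where "p i = snd (s i)" for i
      have s: "s i = (axis i 1, p i)" "p i \<in> A i" for i
        using cs(4) by (auto simp: p_def mem_Times_iff prod_eq_iff)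
      have "z = ((\<chi> i. c i), (\<Sum>i\<in>UNIV. c i *\<^sub>R p i))"
        unfolding cs(1) s(1) by (rule mix)
      then show "z \<in> ?M'" using cs(2,3) s(2) by blast
    qed
    show "?M' \<subseteq> ?M"
    proof
      fix z assume "z \<in> ?M'"
      then obtain c p where cp: "z = ((\<chi> i. c i), (\<Sum>i\<in>UNIV. c i *\<^sub>R p i))" "\<forall>i. Q (c i)"
        "sum c UNIV = 1" "\<forall>i. p i \<in> A i" by blast
      then have "z = (\<Sum>i\<in>UNIV. c i *\<^sub>R (axis i 1, p i))"
        by (simp only: mix)
      moreover have "\<forall>i. (axis i 1, p i) \<in> {axis i 1} \<times> A i"
        using cp(4) by simp
      ultimately show "z \<in> ?M"
        using cp(2,3) by (intro CollectI exI[of _ c] exI[of _ "\<lambda>i. (axis i 1, p i)"]) simp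
    qed
  qed
  show ?thesis
  proof
    assume "(l, x) \<in> dilate n ?M"
    then obtain z where z: "z \<in> ?M'" "(l, x) = real n *\<^sub>R z"
      unfolding M unfolding dilate_def by blast
    then obtain c p where cp: "l = real n *\<^sub>R (\<chi> i. c i)" "x = real n *\<^sub>R (\<Sum>i\<in>UNIV. c i *\<^sub>R p i)"
      "\<forall>i. Q (c i)" "sum c UNIV = 1" "\<forall>i. p i \<in> A i"
      by fastforce
    then show ?R
      using n by (auto simp: Q scaleR_sum_right simp flip: sum_distrib_left)
  next
    assume R: ?R
    then obtain p where p: "\<forall>i. p i \<in> A i" "x = (\<Sum>i\<in>UNIV. l $ i *\<^sub>R p i)" by blast
    \<comment> \<open>Dividing by \<open>n\<close> normalises the coefficient sum to 1;
      \<open>Q\<close> is invariant under this positive rescaling.\<close>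
    let ?c = "\<lambda>i. inverse (real n) * l $ i"
    have "((\<chi> i. ?c i), (\<Sum>i\<in>UNIV. ?c i *\<^sub>R p i)) \<in> ?M'"
      using R p n by (auto simp: Q simp flip: sum_distrib_left)
    moreover have "(l, x) = real n *\<^sub>R ((\<chi> i. ?c i), (\<Sum>i\<in>UNIV. ?c i *\<^sub>R p i))"
      using n p by (simp add: vec_eq_iff scaleR_sum_right flip: mult.assoc)
    ultimately show "(l, x) \<in> dilate n ?M"
      unfolding M unfolding dilate_def by (rule image_eqI[rotated])
  qed
qed

lemma nonneg_int_vec_obtains:
  fixes l :: "real^'m"
  assumes "l \<in> int_points" "\<And>i. 0 \<le> l $ i"
  obtains a where "l = (\<chi> i. real (a i))"
proof
  show "l = (\<chi> i. real (nat \<lfloor>l $ i\<rfloor>))"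
    using assms by (auto simp: int_points_vec vec_eq_iff)
qed

lemma vec_of_nat_int_points: "(\<chi> i. real (a i)) \<in> int_points"
  by (simp add: int_points_vec)

context
  fixes P :: "'m::finite \<Rightarrow> (real^'n) set"
  assumes P: "\<And>i. lattice_polytope (P i)"
begin

lemma cayley_sum_eq:
  "cayley_sum P = {\<Sum>i\<in>UNIV. c i *\<^sub>R s i | c s.
     (\<forall>i. 0 \<le> c i) \<and> sum c UNIV = 1 \<and> (\<forall>i. s i \<in> {axis i 1} \<times> P i)}"
  unfolding cayley_sum_def
  by (subst convex_hull_finite_union)
     (auto simp: P lattice_polytope_convex lattice_polytope_nonempty convex_Times)

text \<open>The relative interior of the hull of finitely many nonempty convex sets consists of the
  mixtures with strictly positive weights of relatively interior points; the singleton factor is its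
  own relative interior.\<close>

lemma rel_interior_cayley_sum:
  "rel_interior (cayley_sum P) = {\<Sum>i\<in>UNIV. c i *\<^sub>R s i | c s.
     (\<forall>i. 0 < c i) \<and> sum c UNIV = 1 \<and> (\<forall>i. s i \<in> {axis i 1} \<times> rel_interior (P i))}"
  unfolding cayley_sum_def
  by (subst rel_interior_convex_hull_union)
     (auto simp: P lattice_polytope_convex lattice_polytope_nonempty convex_Times rel_interior_Times)

lemma dilate_cayley_sum_int_points:
  "(l, x) \<in> dilate n (cayley_sum P) \<inter> int_points \<longleftrightarrow>
     (\<exists>a. l = (\<chi> i. real (a i)) \<and> sum a UNIV = n \<and>
          x \<in> (\<Sum>i\<in>UNIV. dilate (a i) (P i)) \<inter> int_points)"
\<comment> \<open>The description by mixtures divides by \<open>n\<close>. For \<open>n = 0\<close>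
  the dilate is \<open>{0}\<close> and the only possible \<open>a\<close> is the zero
  vector.\<close>
proof (cases "n = 0")
  case True
  have "cayley_sum P \<noteq> {}"
    using P lattice_polytope_cayley_sum lattice_polytope_nonempty by blast
  then have "(l, x) \<in> dilate n (cayley_sum P) \<inter> int_points \<longleftrightarrow> l = 0 \<and> x = 0"
    using True by (auto simp: set_zero zero_prod_def int_points_prod)
  also have "\<dots> \<longleftrightarrow> l = (\<chi> i. real 0) \<and> x \<in> (\<Sum>i\<in>UNIV. dilate 0 (P i)) \<inter> int_points"
    by (simp add: P lattice_polytope_nonempty) (simp add: set_zero zero_vec_def)
  also have "\<dots> \<longleftrightarrow> (\<exists>a. a = (\<lambda>_. 0) \<and> l = (\<chi> i. real (a i)) \<and>
      x \<in> (\<Sum>i\<in>UNIV. dilate (a i) (P i)) \<inter> int_points)"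
    by simp
  also have "\<dots> \<longleftrightarrow> (\<exists>a. l = (\<chi> i. real (a i)) \<and> sum a UNIV = n \<and>
      x \<in> (\<Sum>i\<in>UNIV. dilate (a i) (P i)) \<inter> int_points)"
    using True by (intro ex_cong1) (auto simp: fun_eq_iff)
  finally show ?thesis .
next
  case False
  have mem: "(l, x) \<in> dilate n (cayley_sum P) \<longleftrightarrow> (\<forall>i. 0 \<le> l $ i) \<and> (\<Sum>i\<in>UNIV. l $ i) = real n \<and>
     (\<exists>p. (\<forall>i. p i \<in> P i) \<and> x = (\<Sum>i\<in>UNIV. l $ i *\<^sub>R p i))" for l x
    unfolding cayley_sum_eq using False
    by (intro mem_dilate_mixtures) (auto simp: zero_le_mult_iff)
  show ?thesis
  proof
    assume *: "(l, x) \<in> dilate n (cayley_sum P) \<inter> int_points"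
    obtain a where a: "l = (\<chi> i. real (a i))"
      by (rule nonneg_int_vec_obtains[of l]) (use * in \<open>auto simp: mem int_points_prod\<close>)
    have "sum a UNIV = n"
      using * by (simp add: mem a flip: of_nat_sum)
    then show "\<exists>a. l = (\<chi> i. real (a i)) \<and> sum a UNIV = n \<and>
          x \<in> (\<Sum>i\<in>UNIV. dilate (a i) (P i)) \<inter> int_points"
      using * by (intro exI[of _ a]) (auto simp: mem mem_set_sum_dilate a int_points_prod)
  next
    assume "\<exists>a. l = (\<chi> i. real (a i)) \<and> sum a UNIV = n \<and>
          x \<in> (\<Sum>i\<in>UNIV. dilate (a i) (P i)) \<inter> int_points"
    then show "(l, x) \<in> dilate n (cayley_sum P) \<inter> int_points"
      by (auto simp: mem mem_set_sum_dilate int_points_prod vec_of_nat_int_points)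
  qed
qed

text \<open>Relative interiors of convex sets commute with dilation and Minkowski sums, so the
  mixtures of relatively interior points over a positive vector \<open>a\<close> fill the relative
  interior of the fibre.\<close>

lemma rel_interior_dilate_cayley_sum_int_points:
  assumes n: "n > 0"
  shows "(l, x) \<in> rel_interior (dilate n (cayley_sum P)) \<inter> int_points \<longleftrightarrow>
     (\<exists>a. l = (\<chi> i. real (a i)) \<and> (\<forall>i. 0 < a i) \<and> sum a UNIV = n \<and>
          x \<in> rel_interior (\<Sum>i\<in>UNIV. dilate (a i) (P i)) \<inter> int_points)"
proof -
  have mem: "(l, x) \<in> rel_interior (dilate n (cayley_sum P)) \<longleftrightarrow>
     (\<forall>i. 0 < l $ i) \<and> (\<Sum>i\<in>UNIV. l $ i) = real n \<and>
     (\<exists>p. (\<forall>i. p i \<in> rel_interior (P i)) \<and> x = (\<Sum>i\<in>UNIV. l $ i *\<^sub>R p i))" for l x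
    unfolding rel_interior_dilate[OF convex_cayley_sum] rel_interior_cayley_sum using n
    by (intro mem_dilate_mixtures) (auto simp: zero_less_mult_iff)
  have sum: "rel_interior (\<Sum>i\<in>UNIV. dilate (a i) (P i)) = (\<Sum>i\<in>UNIV. dilate (a i) (rel_interior (P i)))" for a
    using P by (simp add: rel_interior_sum_gen convex_dilate lattice_polytope_convex rel_interior_dilate)
  show ?thesis
  proof
    assume *: "(l, x) \<in> rel_interior (dilate n (cayley_sum P)) \<inter> int_points"
    obtain a where a: "l = (\<chi> i. real (a i))"
      by (rule nonneg_int_vec_obtains[of l]) (use * in \<open>auto simp: mem int_points_prod less_imp_le\<close>)
    have "sum a UNIV = n"
      using * by (simp add: mem a flip: of_nat_sum)
    then show "\<exists>a. l = (\<chi> i. real (a i)) \<and> (\<forall>i. 0 < a i) \<and> sum a UNIV = n \<and>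
          x \<in> rel_interior (\<Sum>i\<in>UNIV. dilate (a i) (P i)) \<inter> int_points"
      using * by (intro exI[of _ a]) (auto simp: mem sum mem_set_sum_dilate a int_points_prod)
  next
    assume "\<exists>a. l = (\<chi> i. real (a i)) \<and> (\<forall>i. 0 < a i) \<and> sum a UNIV = n \<and>
          x \<in> rel_interior (\<Sum>i\<in>UNIV. dilate (a i) (P i)) \<inter> int_points"
    then show "(l, x) \<in> rel_interior (dilate n (cayley_sum P)) \<inter> int_points"
      by (auto simp: mem sum mem_set_sum_dilate int_points_prod vec_of_nat_int_points)
  qed
qed

end

section \<open>Sums with a vector of multiplicities\<close>

lemma multisum_sum: "multisum n (\<Sum>i\<in>I. A i) = (\<Sum>i\<in>I. multisum n (A i))"
  unfolding multisum_def by (rule sum.swap)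

lemma multisum_mult: "multisum (m * n) A = multisum m (multisum n A)"
  by (induction m) (simp_all add: multisum_add, simp add: multisum_def add.commute)

lemma sum_multisum_single:
  fixes A :: "'m::finite \<Rightarrow> 'a::comm_monoid_add set"
  shows "(\<Sum>i\<in>UNIV. multisum (if i = j then n else 0) (A i)) = multisum n (A j)"
  by (subst sum.mono_neutral_cong_right[where S="{j}" and h="\<lambda>i. multisum n (A i)"]) auto

text \<open>A zero multiplicity turns a nonempty summand into the neutral set \<open>{0}\<close>. An
  empty summand would stay empty and absorb the whole sum.\<close>

lemma sum_dilate_restrict:
  fixes A :: "'m::finite \<Rightarrow> 'a::real_vector set"
  assumes "\<And>i. A i \<noteq> {}"
  shows "(\<Sum>i\<in>UNIV. dilate (if i \<in> I then a i else 0) (A i)) = (\<Sum>i\<in>I. dilate (a i) (A i))"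
  by (rule sum.mono_neutral_cong_right) (simp_all add: assms)

lemma sum_multisum_restrict:
  fixes A :: "'m::finite \<Rightarrow> 'a::comm_monoid_add set"
  shows "(\<Sum>i\<in>UNIV. multisum (if i \<in> I then a i else 0) (A i)) = (\<Sum>i\<in>I. multisum (a i) (A i))"
  by (rule sum.mono_neutral_cong_right) simp_all

context
  fixes P :: "'m::finite \<Rightarrow> (real^'n) set"
  assumes P: "\<And>i. lattice_polytope (P i)"
begin

lemma sum_dilate_single:
  "(\<Sum>i\<in>UNIV. dilate (if i = j then n else 0) (P i)) = dilate n (P j)"
  using sum_dilate_restrict[of P "{j}" "\<lambda>_. n"] P lattice_polytope_nonempty by auto

text \<open>Sums of lattice points are lattice points, so this inclusion holds for all lattice
  polytopes; the decomposition properties concern the reverse one.\<close>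

lemma sum_multisum_subset:
  "(\<Sum>i\<in>UNIV. multisum (a i) (P i \<inter> int_points)) \<subseteq> (\<Sum>i\<in>UNIV. dilate (a i) (P i)) \<inter> int_points"
proof -
  have "(\<Sum>i\<in>UNIV. multisum (a i) (P i \<inter> int_points)) \<subseteq> (\<Sum>i\<in>UNIV. dilate (a i) (P i) \<inter> int_points)"
    by (intro set_sum_mono multisum_subset_dilate lattice_polytope_convex lattice_polytope_nonempty P)
  also have "\<dots> \<subseteq> (\<Sum>i\<in>UNIV. dilate (a i) (P i)) \<inter> int_points"
    by (rule int_points_Int_sum_subset)
  finally show ?thesis .
qed

lemma sum_multisum_add_single:
  "(\<Sum>i\<in>UNIV. multisum (a i + (if i = j then 1 else 0)) (A i)) =
     (\<Sum>i\<in>UNIV. multisum (a i) (A i)) + A j" for A :: "'m \<Rightarrow> (real^'n) set"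
  unfolding multisum_add sum.distrib sum_multisum_single by simp

section \<open>Integer decomposition for Cayley and Minkowski sums\<close>

text \<open>Induction on the coordinate sum of \<open>a\<close>: lift \<open>x\<close> to the Cayley
  sum over \<open>a\<close>, split off one lattice point there, and project both parts back.\<close>

lemma idp_cayley_sum_imp:
  assumes C: "idp (cayley_sum P)"
  shows "(\<Sum>i\<in>UNIV. dilate (a i) (P i)) \<inter> int_points \<subseteq>
           (\<Sum>i\<in>UNIV. multisum (a i) (P i \<inter> int_points))"
proof (induction "sum a UNIV" arbitrary: a)
  case 0
  then have "a = (\<lambda>_. 0)" by auto
  then show ?case by (simp add: P lattice_polytope_nonempty)
next
  case (Suc n)
  show ?case
  proof
    fix x assume "x \<in> (\<Sum>i\<in>UNIV. dilate (a i) (P i)) \<inter> int_points"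
    then have "((\<chi> i. real (a i)), x) \<in> dilate (Suc n) (cayley_sum P) \<inter> int_points"
      using Suc.hyps(2) by (subst dilate_cayley_sum_int_points[where P=P, OF P]) auto
    \<comment> \<open>The second summand is written as \<open>dilate 1\<close> so that the
      description of lattice points in dilates applies to it as well.\<close>
    also have "\<dots> = (dilate n (cayley_sum P) \<inter> int_points) + (dilate 1 (cayley_sum P) \<inter> int_points)"
      using C unfolding idp_def by (metis One_nat_def diff_Suc_1 dilate_1 le_add1 plus_1_eq_Suc)
    finally obtain l' x' l y where *: "(l', x') \<in> dilate n (cayley_sum P) \<inter> int_points"
      "(l, y) \<in> dilate 1 (cayley_sum P) \<inter> int_points"
      "((\<chi> i. real (a i)), x) = (l', x') + (l, y)"
      by (metis set_plus_elim surj_pair)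
    obtain a' where a': "l' = (\<chi> i. real (a' i))" "sum a' UNIV = n"
      "x' \<in> (\<Sum>i\<in>UNIV. dilate (a' i) (P i)) \<inter> int_points"
      using *(1) unfolding dilate_cayley_sum_int_points[where P=P, OF P] by blast
    obtain d where d: "l = (\<chi> i. real (d i))" "sum d UNIV = 1"
      "y \<in> (\<Sum>i\<in>UNIV. dilate (d i) (P i)) \<inter> int_points"
      using *(2) unfolding dilate_cayley_sum_int_points[where P=P, OF P] by blast
    \<comment> \<open>Natural numbers with sum 1 form a unit vector, so the point split off comes
      from a single \<open>P j\<close>.\<close>
    obtain j where "d j = 1" "\<forall>i. j \<noteq> i \<longrightarrow> d i = 0"
      using d(2) unfolding sum_eq_1_iff[OF finite] by blast
    then have "d = (\<lambda>i. if i = j then 1 else 0)"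
      by auto
    moreover have "a = (\<lambda>i. a' i + d i)"
      using *(3) a'(1) d(1) by (auto simp: vec_eq_iff fun_eq_iff simp flip: of_nat_add)
    ultimately have a: "a = (\<lambda>i. a' i + (if i = j then 1 else 0))" and y: "y \<in> P j \<inter> int_points"
      using d(3) by (simp_all add: sum_dilate_single)
    have "x = x' + y" using *(3) by simp
    then show "x \<in> (\<Sum>i\<in>UNIV. multisum (a i) (P i \<inter> int_points))"
      unfolding a sum_multisum_add_single using Suc.hyps(1)[of a'] a' y by auto
  qed
qed

lemma idp_cayley_sum_iff:
  "idp (cayley_sum P) \<longleftrightarrow>
     (\<forall>a. (\<Sum>i\<in>UNIV. dilate (a i) (P i)) \<inter> int_points =
          (\<Sum>i\<in>UNIV. multisum (a i) (P i \<inter> int_points)))"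
    (is "_ \<longleftrightarrow> ?R")
proof
  assume "idp (cayley_sum P)"
  then show ?R
    using idp_cayley_sum_imp sum_multisum_subset by blast
next
  assume R: ?R
  have "dilate n (cayley_sum P) \<inter> int_points =
      (dilate (n - 1) (cayley_sum P) \<inter> int_points) + (cayley_sum P \<inter> int_points)"
    (is "_ = ?S") if n: "n \<ge> 1" for n
  proof
    show "dilate n (cayley_sum P) \<inter> int_points \<subseteq> ?S"
    proof clarify
      fix l x assume "(l, x) \<in> dilate n (cayley_sum P)" "(l, x) \<in> int_points"
      then obtain a where a: "l = (\<chi> i. real (a i))" "sum a UNIV = n"
        "x \<in> (\<Sum>i\<in>UNIV. dilate (a i) (P i)) \<inter> int_points"
        using dilate_cayley_sum_int_points[where P=P, OF P] by blast
      \<comment> \<open>Since the entries of \<open>a\<close> sum to \<open>n \<ge> 1\<close>, some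
        \<open>P j\<close> contributes a lattice point that can be split off.\<close>
      obtain j where j: "a j > 0"
        using a(2) n by (metis gr0I not_one_le_zero sum.neutral)
      define a' where "a' = a(j := a j - 1)"
      let ?d = "\<lambda>i. if i = j then 1 else 0 :: nat"
      have aa: "a = (\<lambda>i. a' i + ?d i)"
        using j by (auto simp: a'_def)
      have "x \<in> (\<Sum>i\<in>UNIV. multisum (a' i) (P i \<inter> int_points)) + (P j \<inter> int_points)"
        using a(3) unfolding R[rule_format] unfolding aa sum_multisum_add_single .
      then obtain x' y where xy: "x = x' + y" "y \<in> P j \<inter> int_points"
        "x' \<in> (\<Sum>i\<in>UNIV. dilate (a' i) (P i)) \<inter> int_points"
        using R by (auto elim: set_plus_elim)
      have "sum a' UNIV = n - 1"
        using a(2) unfolding aa sum.distrib by simp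
      then have "((\<chi> i. real (a' i)), x') \<in> dilate (n - 1) (cayley_sum P) \<inter> int_points"
        using xy(3) by (subst dilate_cayley_sum_int_points[where P=P, OF P]) blast
      moreover have "((\<chi> i. real (?d i)), y) \<in> dilate 1 (cayley_sum P) \<inter> int_points"
        using xy(2) by (subst dilate_cayley_sum_int_points[where P=P, OF P], intro exI[of _ ?d])
          (simp add: sum_dilate_single)
      moreover have "(l, x) = ((\<chi> i. real (a' i)), x') + ((\<chi> i. real (?d i)), y)"
        by (simp add: a(1) xy(1) aa vec_eq_iff)
      ultimately show "(l, x) \<in> ?S"
        by (metis One_nat_def dilate_1 set_plus_intro)
    qed
    \<comment> \<open>The reverse inclusion uses only convexity of the Cayley sum.\<close>
    have "?S \<subseteq> (dilate (n - 1) (cayley_sum P) + dilate 1 (cayley_sum P)) \<inter> int_points"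
      using int_points_Int_plus_subset by simp
    then show "?S \<subseteq> dilate n (cayley_sum P) \<inter> int_points"
      using n dilate_add[OF convex_cayley_sum, of "n - 1" 1 P] by simp
  qed
  then show "idp (cayley_sum P)"
    by (simp add: idp_def lattice_polytope_cayley_sum P)
qed

text \<open>The decomposition for all vectors \<open>a\<close> specialises to a vector supported at
  one index, which gives IDP of each \<open>P i\<close>, and to one supported on \<open>I\<close>,
  which gives the tuple condition. Conversely, the tuple condition for \<open>UNIV\<close> splits a
  lattice point into lattice points of the \<open>dilate (a i) (P i)\<close>, and IDP of each
  \<open>P i\<close> splits these further.\<close>

lemma idp_cayley_sum_iff_idp_tuple:
  "idp (cayley_sum P) \<longleftrightarrow> (\<forall>i. idp (P i)) \<and> (\<forall>a. idp_tuple (\<lambda>i. dilate (a i) (P i)))"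
proof
  assume "idp (cayley_sum P)"
  then have R: "(\<Sum>i\<in>UNIV. dilate (a i) (P i)) \<inter> int_points =
          (\<Sum>i\<in>UNIV. multisum (a i) (P i \<inter> int_points))" for a
    by (simp add: idp_cayley_sum_iff)
  have dil: "dilate n (P j) \<inter> int_points = multisum n (P j \<inter> int_points)" for n j
    using R[of "\<lambda>i. if i = j then n else 0"] by (simp only: sum_dilate_single sum_multisum_single)
  have "(\<Sum>i\<in>I. dilate (a i) (P i)) \<inter> int_points = (\<Sum>i\<in>I. dilate (a i) (P i) \<inter> int_points)" for a I
    using R[of "\<lambda>i. if i \<in> I then a i else 0"]
    by (simp only: sum_dilate_restrict P lattice_polytope_nonempty not_False_eq_True sum_multisum_restrict dil)
  then show "(\<forall>i. idp (P i)) \<and> (\<forall>a. idp_tuple (\<lambda>i. dilate (a i) (P i)))"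
    using dil by (simp add: idp_iff P idp_tuple_def lattice_polytope_dilate)
next
  assume "(\<forall>i. idp (P i)) \<and> (\<forall>a. idp_tuple (\<lambda>i. dilate (a i) (P i)))"
  then show "idp (cayley_sum P)"
    by (simp add: idp_cayley_sum_iff idp_iff P idp_tuple_def)
qed

text \<open>The \<open>n\<close>-th dilate of the sum is the sum for the vector \<open>n a\<close>.
  Decomposing it over \<open>n a\<close> and regrouping into \<open>n\<close> blocks, each a sum for
  \<open>a\<close>, yields the claim.\<close>

lemma idp_minkowski_sum:
  assumes "idp (cayley_sum P)"
  shows "idp (\<Sum>i\<in>UNIV. dilate (a i) (P i))"
proof -
  have R: "(\<Sum>i\<in>UNIV. dilate (a i) (P i)) \<inter> int_points =
          (\<Sum>i\<in>UNIV. multisum (a i) (P i \<inter> int_points))" for a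
    using assms by (simp add: idp_cayley_sum_iff)
  have "lattice_polytope (\<Sum>i\<in>UNIV. dilate (a i) (P i))"
    by (intro lattice_polytope_sum lattice_polytope_dilate P)
  then show ?thesis
    by (simp add: idp_iff dilate_sum dilate_dilate R multisum_sum multisum_mult)
qed

section \<open>Levelness of the Minkowski sum\<close>

lemma level_minkowski_sum:
  assumes "level_of_index (cayley_sum P) CARD('m)"
  shows "level_of_index (\<Sum>i\<in>UNIV. P i) 1"
proof -
  let ?Q = "\<Sum>i\<in>UNIV. P i" and ?C = "cayley_sum P"
  have Q: "lattice_polytope ?Q" by (intro lattice_polytope_sum P)
  have nQ: "(\<Sum>i\<in>UNIV. dilate n (P i)) = dilate n ?Q" for n
    by (simp add: dilate_sum)
  have interior_C: "l = (\<chi> i. 1) \<and> x \<in> rel_interior ?Q \<inter> int_points"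
    if lx: "(l, x) \<in> rel_interior (dilate CARD('m) ?C) \<inter> int_points" for l x
  proof -
    obtain a where a: "l = (\<chi> i. real (a i))" "\<And>i. 0 < a i" "sum a UNIV = CARD('m)"
      "x \<in> rel_interior (\<Sum>i\<in>UNIV. dilate (a i) (P i)) \<inter> int_points"
      using rel_interior_dilate_cayley_sum_int_points[where P=P, OF P, of "CARD('m)" l x] lx
      by auto
    \<comment> \<open>All entries are at least 1, so a larger entry would push the sum above
      \<open>CARD('m)\<close>.\<close>
    have "a = (\<lambda>_. 1)"
    proof (rule ccontr)
      assume "a \<noteq> (\<lambda>_. 1)"
      then obtain j where "a j \<noteq> 1" by auto
      then have "1 < a j" using a(2)[of j] by simp
      then have "(\<Sum>i\<in>(UNIV::'m set). 1) < sum a UNIV"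
        using a(2) by (intro sum_strict_mono_ex1) (auto simp: Suc_leI)
      then show False using a(3) by simp
    qed
    then show ?thesis using a by simp
  qed
  have C: "rel_interior (dilate CARD('m) ?C) \<inter> int_points \<noteq> {}"
    "\<And>n. n \<ge> CARD('m) \<Longrightarrow> rel_interior (dilate n ?C) \<inter> int_points =
       (rel_interior (dilate CARD('m) ?C) \<inter> int_points) + (dilate (n - CARD('m)) ?C \<inter> int_points)"
    using assms unfolding level_of_index_def by blast+
  have "rel_interior ?Q \<inter> int_points \<noteq> {}"
    using C(1) interior_C by (metis (no_types, lifting) ex_in_conv surj_pair)
  moreover have "rel_interior (dilate n ?Q) \<inter> int_points =
      (rel_interior ?Q \<inter> int_points) + (dilate (n - 1) ?Q \<inter> int_points)" (is "?L = ?S")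
    if n: "n \<ge> 1" for n
  proof
    show "?L \<subseteq> ?S"
    proof
      fix x assume x: "x \<in> ?L"
      \<comment> \<open>The fibre over \<open>(n, ..., n)\<close> is \<open>dilate n ?Q\<close>, and
        this vector has coordinate sum \<open>n * CARD('m)\<close>; levelness of the Cayley sum is
        therefore used at that dilate.\<close>
      have m: "n * CARD('m) \<ge> CARD('m)" using n by simp
      have "((\<chi> i. real n), x) \<in> rel_interior (dilate (n * CARD('m)) ?C) \<inter> int_points"
        using x n by (subst rel_interior_dilate_cayley_sum_int_points[where P=P, OF P])
          (auto intro!: exI[of _ "\<lambda>_. n"] simp: nQ)
      then obtain l y k z where *: "((\<chi> i. real n), x) = (l, y) + (k, z)"
        "(l, y) \<in> rel_interior (dilate CARD('m) ?C) \<inter> int_points"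
        "(k, z) \<in> dilate (n * CARD('m) - CARD('m)) ?C \<inter> int_points"
        unfolding C(2)[OF m] by (metis set_plus_elim surj_pair)
      have y: "l = (\<chi> i. 1)" "y \<in> rel_interior ?Q \<inter> int_points"
        using interior_C[OF *(2)] by auto
      obtain b where b: "k = (\<chi> i. real (b i))"
        "z \<in> (\<Sum>i\<in>UNIV. dilate (b i) (P i)) \<inter> int_points"
        using *(3) dilate_cayley_sum_int_points[where P=P, OF P] by blast
      \<comment> \<open>Removing the all-ones vector from \<open>(n, ..., n)\<close> leaves
        \<open>n - 1\<close> in every coordinate, so \<open>z\<close> lies in
        \<open>dilate (n - 1) ?Q\<close>.\<close>
      have "b = (\<lambda>_. n - 1)"
      proof
        fix i
        have "real n = 1 + real (b i)" using *(1) y b by (simp add: vec_eq_iff)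
        then show "b i = n - 1" by simp
      qed
      then show "x \<in> ?S"
        using b y *(1) by (auto simp: nQ)
    qed
    have "rel_interior ?Q + dilate (n - 1) ?Q \<subseteq> rel_interior (dilate n ?Q)"
      using rel_interior_plus_dilate_subset[OF lattice_polytope_convex[OF Q], of "n - 1"] n by simp
    then have "(rel_interior ?Q + dilate (n - 1) ?Q) \<inter> int_points \<subseteq> ?L"
      by blast
    then show "?S \<subseteq> ?L"
      using int_points_Int_plus_subset by blast
  qed
  \<comment> \<open>Minimality of the index 1 among positive integers is immediate.\<close>
  ultimately show ?thesis
    using Q by (simp add: level_of_index_def Suc_le_eq)
qed

end

theorem theorem0p4:
  fixes P :: "'m::finite \<Rightarrow> (real^'n) set"
  assumes "\<And>i. lattice_polytope (P i)"
  shows "(idp (cayley_sum P) \<longleftrightarrow>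
            (\<forall>i. idp (P i)) \<and> (\<forall>a::'m \<Rightarrow> nat. idp_tuple (\<lambda>i. dilate (a i) (P i)))) \<and>
         (idp (cayley_sum P) \<longrightarrow>
            (\<forall>a::'m \<Rightarrow> nat. idp (\<Sum>i\<in>UNIV. dilate (a i) (P i)))) \<and>
         (level_of_index (cayley_sum P) CARD('m) \<longrightarrow> level_of_index (\<Sum>i\<in>UNIV. P i) 1)"
proof (intro conjI impI allI)
  show "idp (cayley_sum P) \<longleftrightarrow>
      (\<forall>i. idp (P i)) \<and> (\<forall>a::'m \<Rightarrow> nat. idp_tuple (\<lambda>i. dilate (a i) (P i)))"
    using assms by (rule idp_cayley_sum_iff_idp_tuple)
  show "idp (\<Sum>i\<in>UNIV. dilate (a i) (P i))" if "idp (cayley_sum P)" for a :: "'m \<Rightarrow> nat"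
    using assms that by (rule idp_minkowski_sum)
  show "level_of_index (\<Sum>i\<in>UNIV. P i) 1" if "level_of_index (cayley_sum P) CARD('m)"
    using assms that by (rule level_minkowski_sum)
qed

end
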